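(* Let $r,s,\ell\in\mathbb{N}$ with $r\ge 2$ and $s\ge r-1$. Let $G$ be a graph with maximum degree $\Delta(G)=\Delta$, minimum degree $\delta(G)=\delta$, and choice number $\mathrm{ch}(G)=\ell$. If $$\bigl((r+1)\log(\Delta)+(r-1)\log(r)+1\bigr)\left(\frac{\ell+s}{s}\right)^{r-1}\le \delta,$$ then $$\mathrm{ch}_r(G)\le \mathrm{ch}(G)+s+r-2.$$
   Context: Graphs are finite and simple; $\mathbb{N}=\{1,2,\dots\}$; $\log$ is the natural logarithm. $N_G(v)$ is the set of neighbors of $v$ and $d_G(v)=|N_G(v)|$. The choice number $\mathrm{ch}(G)$ is the least $k$ such that for every assignment of sets (lists) $L(v)$ with $|L(v)|\ge k$ to the vertices $v\in V(G)$ there is a proper coloring $f$ of $G$ with $f(v)\in L(v)$ for all $v$. For $r\in\mathbb{N}$, an $r$-dynamic coloring of $G$ is a proper coloring $f$ such that $|f(N_G(v))|\ge\min\{r,d_G(v)\}$ for every vertex $v$. The $r$-dynamic choosability $\mathrm{ch}_r(G)$ is the least positive integer $k$ such that for every assignment of lists $L(v)$ with $|L(v)|\ge k$ to the vertices $v\in V(G)$ there is an $r$-dynamic coloring $f$ of $G$ with $f(v)\in L(v)$ for all $v\in V(G)$. *)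

theory Defs
  imports Complex_Main
begin

text \<open>As usual, graphs have at least one vertex; this is what makes the maximum and
  minimum degree meaningful.\<close>

locale fin_sgraph =
  fixes V :: "'a set" and E :: "'a set set"
  assumes finite_V: "finite V"
    and V_nonempty: "V \<noteq> {}"
    and edges: "e \<in> E \<Longrightarrow> e \<subseteq> V \<and> card e = 2"

definition neighbors :: "'a set set \<Rightarrow> 'a \<Rightarrow> 'a set" where
  "neighbors E v = {u. {v, u} \<in> E}"

definition degree :: "'a set set \<Rightarrow> 'a \<Rightarrow> nat" where
  "degree E v = card (neighbors E v)"

definition max_degree :: "'a set \<Rightarrow> 'a set set \<Rightarrow> nat" where
  "max_degree V E = Max (degree E ` V)"

definition min_degree :: "'a set \<Rightarrow> 'a set set \<Rightarrow> nat" where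
  "min_degree V E = Min (degree E ` V)"

text \<open>Colors are natural numbers: on a finite graph every list may be shrunk to a finite one,
  and finitely many finite lists can be renamed into \<^typ>\<open>nat\<close>.\<close>

definition proper_coloring :: "'a set set \<Rightarrow> ('a \<Rightarrow> nat) \<Rightarrow> bool" where
  "proper_coloring E f \<longleftrightarrow> (\<forall>u v. {u, v} \<in> E \<longrightarrow> f u \<noteq> f v)"

definition dynamic_coloring :: "nat \<Rightarrow> 'a set \<Rightarrow> 'a set set \<Rightarrow> ('a \<Rightarrow> nat) \<Rightarrow> bool" where
  "dynamic_coloring r V E f \<longleftrightarrow>
     proper_coloring E f \<and> (\<forall>v\<in>V. card (f ` neighbors E v) \<ge> min r (degree E v))"

text \<open>The disjunct for infinite lists is needed because \<^const>\<open>card\<close> of an infinite set is \<open>0\<close>.\<close>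

definition list_assignment :: "'a set \<Rightarrow> nat \<Rightarrow> ('a \<Rightarrow> nat set) \<Rightarrow> bool" where
  "list_assignment V k L \<longleftrightarrow> (\<forall>v\<in>V. infinite (L v) \<or> card (L v) \<ge> k)"

definition choosable :: "'a set \<Rightarrow> 'a set set \<Rightarrow> nat \<Rightarrow> bool" where
  "choosable V E k \<longleftrightarrow>
     (\<forall>L. list_assignment V k L \<longrightarrow> (\<exists>f. proper_coloring E f \<and> (\<forall>v\<in>V. f v \<in> L v)))"

definition choice_number :: "'a set \<Rightarrow> 'a set set \<Rightarrow> nat" where
  "choice_number V E = (LEAST k. choosable V E k)"

definition dynamic_choosable :: "nat \<Rightarrow> 'a set \<Rightarrow> 'a set set \<Rightarrow> nat \<Rightarrow> bool" where
  "dynamic_choosable r V E k \<longleftrightarrow>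
     (\<forall>L. list_assignment V k L \<longrightarrow> (\<exists>f. dynamic_coloring r V E f \<and> (\<forall>v\<in>V. f v \<in> L v)))"

definition dynamic_choice_number :: "nat \<Rightarrow> 'a set \<Rightarrow> 'a set set \<Rightarrow> nat" where
  "dynamic_choice_number r V E = (LEAST k. 0 < k \<and> dynamic_choosable r V E k)"

text \<open>Both minima are attained: lists of size \<^term>\<open>card V\<close> admit an injective coloring.\<close>

lemma injective_choice:
  fixes L :: "'a \<Rightarrow> nat set"
  assumes "finite W" "\<forall>v\<in>W. infinite (L v) \<or> card (L v) \<ge> card W"
  shows "\<exists>f. inj_on f W \<and> (\<forall>v\<in>W. f v \<in> L v)"
  using assms
proof (induction W rule: finite_induct)
  case empty
  then show ?case by simp
next
  case (insert x W)
  then obtain f where f: "inj_on f W" "\<forall>v\<in>W. f v \<in> L v"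
    by fastforce
  have "\<not> L x \<subseteq> f ` W"
  proof
    assume sub: "L x \<subseteq> f ` W"
    have "finite (f ` W)" using insert.hyps by simp
    with sub have "finite (L x)" "card (L x) \<le> card (f ` W)"
      by (auto intro: finite_subset card_mono)
    moreover have "card (f ` W) \<le> card W"
      using insert.hyps by (simp add: card_image_le)
    ultimately show False
      using insert.prems insert.hyps by auto
  qed
  then obtain c where c: "c \<in> L x" "c \<notin> f ` W" by blast
  have "f(x := c) ` W = f ` W" "inj_on (f(x := c)) W"
    using insert.hyps(2) f(1) by (auto simp: inj_on_def)
  then have "inj_on (f(x := c)) (insert x W)"
    using c(2) insert.hyps(2) by (auto simp: inj_on_insert)
  moreover have "\<forall>v\<in>insert x W. (f(x := c)) v \<in> L v"
    using f(2) c(1) by auto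
  ultimately show ?case by blast
qed

context fin_sgraph
begin

lemma neighbors_subset: "neighbors E v \<subseteq> V"
  using edges by (auto simp: neighbors_def)

lemma injective_dynamic_coloring:
  assumes "inj_on f V"
  shows "dynamic_coloring r V E f"
proof -
  have "f u \<noteq> f v" if "{u, v} \<in> E" for u v
  proof -
    have "u \<in> V" "v \<in> V" "u \<noteq> v"
      using edges[OF that] by (auto simp: card_insert_if split: if_splits)
    with assms show ?thesis by (auto dest: inj_onD)
  qed
  moreover have "card (f ` neighbors E v) = degree E v" for v
    unfolding degree_def
    by (rule card_image) (rule inj_on_subset[OF assms neighbors_subset])
  ultimately show ?thesis
    by (simp add: dynamic_coloring_def proper_coloring_def)
qed

lemma dynamic_choosable_card: "dynamic_choosable r V E (card V)"
  unfolding dynamic_choosable_def list_assignment_def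
  using injective_choice[OF finite_V] injective_dynamic_coloring by blast

lemma choosable_card: "choosable V E (card V)"
  using dynamic_choosable_card[of 0]
  unfolding choosable_def dynamic_choosable_def dynamic_coloring_def by blast

lemma choosable_choice_number: "choosable V E (choice_number V E)"
  unfolding choice_number_def by (rule LeastI) (rule choosable_card)

lemma dynamic_choosable_dynamic_choice_number:
  "0 < dynamic_choice_number r V E \<and> dynamic_choosable r V E (dynamic_choice_number r V E)"
  unfolding dynamic_choice_number_def
  by (rule LeastI[where k = "card V"])
     (use dynamic_choosable_card finite_V V_nonempty in \<open>auto simp: card_gt_0_iff\<close>)

end

end

theory Submission
  imports Defs "HOL-Library.FuncSet"
begin

text \<open>
  Put \<open>k = l + s + r - 2\<close> and let lists of size \<open>k\<close> be given.  The idea is to shrink every list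
  \<open>L u\<close> to a sublist \<open>L' u\<close> of size \<open>l\<close> such that no set of at most \<open>r - 1\<close> colors meets all the
  sublists on the neighborhood of a vertex.  Since \<open>l\<close> is the choice number, there is a proper
  coloring from the sublists, and any such coloring uses at least \<open>r\<close> colors on every
  neighborhood.

  The sublists are chosen uniformly and independently at random.  A fixed set of \<open>r - 1\<close> colors
  misses a given sublist with probability at least \<open>q = (s / (l + s)) ^ (r - 1)\<close>
  (\<open>subsets_avoiding_lower\<close>).  A union bound over all color sets would be too wasteful, since the
  lists on a neighborhood may be very different from each other.  Instead the color set is built
  while the sublists are revealed one at a time: a color is added only if the current sublist is
  still missed, and then it has to come from that sublist.  This shows that some set of at most
  \<open>r - 1\<close> colors meets all sublists on a neighborhood of size \<open>d\<close> with probability at most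
  \<open>k ^ (r - 1) * (1 - q) ^ d\<close> (\<open>hit_by_few_upper\<close>).

  Such an event depends only on the sublists at the neighbors of a vertex, so it shares
  random choices with at most \<open>\<Delta>\<^sup>2\<close> events, itself included.  If \<open>k \<le> r * \<Delta>\<close>, the assumed
  inequality bounds the probability by \<open>1 / (e * \<Delta>\<^sup>2)\<close>, and the Lovasz Local Lemma
  (\<open>lovasz_local_symmetric\<close>) avoids all events simultaneously.  If \<open>k > r * \<Delta>\<close>, coloring the
  vertices greedily already succeeds (\<open>dynamic_choosable_greedy\<close>).

  All probabilities are expressed by counting in finite products of families of sets.
\<close>

section \<open>A symmetric Lovasz Local Lemma\<close>

text \<open>The estimate that brings the constant \<open>e\<close> into the local lemma.\<close>

lemma exp_minus_one_le_power:
  fixes m :: nat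
  assumes "m \<ge> 2"
  shows "exp (- 1) \<le> (1 - 1 / real m) ^ (m - 1)"
proof -
  define d where "d = real (m - 1)"
  have d: "d > 0" "real m = d + 1" using assms by (auto simp: d_def)
  have "(1 + 1 / d) ^ (m - 1) \<le> exp (1 / d) ^ (m - 1)"
    using d by (intro power_mono) (auto simp: add_pos_pos less_imp_le exp_ge_add_one_self)
  also have "\<dots> = exp 1"
    using d by (simp add: d_def flip: exp_of_nat_mult)
  finally have le: "(1 + 1 / d) ^ (m - 1) \<le> exp 1" .
  have "1 - 1 / real m = inverse (1 + 1 / d)"
    using d by (simp add: field_simps)
  hence eq: "(1 - 1 / real m) ^ (m - 1) = inverse ((1 + 1 / d) ^ (m - 1))"
    by (simp add: power_inverse)
  have "0 < (1 + 1 / d) ^ (m - 1)" using d by (simp add: add_pos_pos)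
  then show ?thesis
    unfolding eq exp_minus using le by (intro le_imp_inverse_le) auto
qed

text \<open>The local lemma for the uniform distribution on \<open>\<Omega>\<close>.  Independence is replaced by the
  weaker one-sided condition \<open>indep\<close>: avoiding events outside \<open>\<Gamma> i\<close> does not raise the
  probability of \<open>A i\<close> above \<open>p\<close>.  By induction on \<open>T\<close>, conditioned on avoiding all events in
  \<open>T\<close>, every further event has probability at most \<open>1 / m\<close>: avoiding the at most \<open>m - 1\<close> events
  in \<open>T \<inter> \<Gamma> i\<close> costs at most a factor \<open>(1 - 1 / m) ^ (m - 1) \<ge> 1 / e\<close>.\<close>

lemma lovasz_local_symmetric:
  fixes A :: "'i \<Rightarrow> 'w set" and p :: real and m :: nat
  assumes "finite \<Omega>" "\<Omega> \<noteq> {}" "finite I" "m \<ge> 2"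
    and \<Gamma>: "\<And>i. i \<in> I \<Longrightarrow> i \<in> \<Gamma> i \<and> finite (\<Gamma> i) \<and> card (\<Gamma> i) \<le> m"
    and p: "p * exp 1 * m \<le> 1"
    and indep: "\<And>i T. \<lbrakk>i \<in> I; T \<subseteq> I; T \<inter> \<Gamma> i = {}\<rbrakk> \<Longrightarrow>
      card (A i \<inter> (\<Omega> - (\<Union>j\<in>T. A j))) \<le> p * card (\<Omega> - (\<Union>j\<in>T. A j))"
  shows "\<Omega> - (\<Union>i\<in>I. A i) \<noteq> {}"
proof -
  define B where "B T = \<Omega> - (\<Union>j\<in>T. A j)" for T
  have finB: "finite (B T)" for T using assms(1) by (simp add: B_def)
  have card_B_insert:
    "real (card (B (insert i T))) = card (B T) - real (card (A i \<inter> B T))" for i T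
  proof -
    have "B (insert i T) = B T - A i \<inter> B T" by (auto simp: B_def)
    then show ?thesis
      by (simp add: card_Diff_subset finB card_mono of_nat_diff)
  qed
  define y where "y = 1 - 1 / real m"
  have y: "y > 0" using assms(4) by (simp add: y_def)
  have step: "y * card (B T) \<le> card (B (insert i T))"
    if "card (A i \<inter> B T) \<le> card (B T) / m" for i T
    using that by (simp add: card_B_insert y_def algebra_simps)
  have main: "card (A i \<inter> B T) \<le> card (B T) / m" if "i \<in> I" "T \<subseteq> I" for i T
    using that
  proof (induction "card T" arbitrary: i T rule: less_induct)
    case less
    have "finite T" using less.prems assms(3) finite_subset by blast
    show ?case
    proof (cases "i \<in> T")
      case True
      hence "A i \<inter> B T = {}" by (auto simp: B_def)
      then show ?thesis by simp
    next
      case False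
      define T1 T2 where "T1 = T \<inter> \<Gamma> i" and "T2 = T - \<Gamma> i"
      have T: "T = T2 \<union> T1" "T1 \<inter> T2 = {}" "finite T1"
        using \<open>finite T\<close> by (auto simp: T1_def T2_def)
      have "card T1 \<le> card (\<Gamma> i - {i})"
        using False \<Gamma>[OF less.prems(1)] by (intro card_mono) (auto simp: T1_def)
      also have "\<dots> = card (\<Gamma> i) - 1"
        using \<Gamma>[OF less.prems(1)] by simp
      also have "\<dots> \<le> m - 1"
        using \<Gamma>[OF less.prems(1)] by (intro diff_le_mono) simp
      finally have cardT1: "card T1 \<le> m - 1" .
      have "y ^ card Z * card (B T2) \<le> card (B (T2 \<union> Z))" if "finite Z" "Z \<subseteq> T1" for Z
        using that
      proof (induction Z rule: finite_induct)
        case empty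
        show ?case by simp
      next
        case (insert z Z)
        have "z \<in> T" "T2 \<union> Z \<subseteq> T - {z}" using insert.prems insert.hyps T by auto
        hence "T2 \<union> Z \<subset> T" by blast
        hence "card (T2 \<union> Z) < card T"
          using \<open>finite T\<close> by (simp add: psubset_card_mono)
        hence "y * card (B (T2 \<union> Z)) \<le> card (B (insert z (T2 \<union> Z)))"
          using less.prems \<open>z \<in> T\<close> \<open>T2 \<union> Z \<subset> T\<close> by (intro step less.hyps) auto
        moreover have "y * (y ^ card Z * card (B T2)) \<le> y * card (B (T2 \<union> Z))"
          using insert y by (intro mult_left_mono) auto
        ultimately show ?case using insert.hyps by (simp add: mult.assoc)
      qed
      from this[of T1] T have ratio: "y ^ card T1 * card (B T2) \<le> card (B T)" by simp
      have "exp (-1) \<le> y ^ (m - 1)"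
        using exp_minus_one_le_power[OF assms(4)] by (simp add: y_def)
      also have "\<dots> \<le> y ^ card T1"
        using y cardT1 by (intro power_decreasing) (auto simp: y_def)
      finally have "exp (-1) * card (B T2) \<le> y ^ card T1 * card (B T2)"
        by (intro mult_right_mono) auto
      with ratio have "exp (-1) * card (B T2) \<le> card (B T)" by linarith
      hence B2: "card (B T2) \<le> exp 1 * card (B T)"
        by (simp add: exp_minus field_simps)
      have "card (A i \<inter> B T) \<le> card (A i \<inter> B T2)"
        using finB by (intro card_mono finite_Int) (auto simp: B_def T2_def)
      hence "real (card (A i \<inter> B T)) \<le> card (A i \<inter> B T2)" by simp
      also have "\<dots> \<le> p * card (B T2)"
        using indep[of i T2] less.prems by (auto simp: B_def T2_def)
      also have "\<dots> \<le> 1 / (exp 1 * m) * card (B T2)"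
        using p assms(4) by (intro mult_right_mono) (auto simp: field_simps)
      also have "\<dots> \<le> 1 / (exp 1 * m) * (exp 1 * card (B T))"
        using B2 by (intro mult_left_mono) auto
      finally show ?thesis by simp
    qed
  qed
  have "0 < card (B T)" if "finite T" "T \<subseteq> I" for T
    using that
  proof (induction T rule: finite_induct)
    case empty
    then show ?case using assms(1,2) by (simp add: B_def card_gt_0_iff)
  next
    case (insert i T)
    have "y * card (B T) \<le> card (B (insert i T))"
      using insert.prems by (intro step main) auto
    moreover have "0 < y * card (B T)" using insert y by simp
    ultimately show ?case by linarith
  qed
  from this[of I] show ?thesis using assms(3) by (simp add: B_def card_gt_0_iff)
qed

section \<open>Counting in products of finite families\<close>

lemma card_PiE_insert_Collect:
  assumes "u \<notin> U" "finite U" "\<And>v. v \<in> insert u U \<Longrightarrow> finite (M v)"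
  shows "card {\<omega> \<in> PiE (insert u U) M. P \<omega>} =
    (\<Sum>S\<in>M u. card {\<omega> \<in> PiE U M. P (\<omega>(u := S))})"
proof -
  define R where "R = (SIGMA S:M u. {\<omega> \<in> PiE U M. P (\<omega>(u := S))})"
  have "{\<omega> \<in> PiE (insert u U) M. P \<omega>} = (\<lambda>(S, \<omega>). \<omega>(u := S)) ` R"
    unfolding PiE_insert_eq R_def by auto
  moreover have "inj_on (\<lambda>(S, \<omega>). \<omega>(u := S)) R"
    by (rule inj_on_subset[OF inj_combinator[OF assms(1), of M]]) (auto simp: R_def)
  ultimately have "card {\<omega> \<in> PiE (insert u U) M. P \<omega>} = card R"
    by (simp add: card_image)
  also have "\<dots> = (\<Sum>S\<in>M u. card {\<omega> \<in> PiE U M. P (\<omega>(u := S))})"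
    unfolding R_def using assms finite_PiE[of U M] by (intro card_SigmaI) auto
  finally show ?thesis .
qed

text \<open>Independence of events that depend on disjoint sets of coordinates.\<close>

lemma card_PiE_split:
  assumes "W \<subseteq> V"
  shows "card {\<omega> \<in> PiE V M. P (restrict \<omega> W) \<and> Q (restrict \<omega> (V - W))} =
    card {\<omega> \<in> PiE W M. P \<omega>} * card {\<omega> \<in> PiE (V - W) M. Q \<omega>}"
proof -
  have "bij_betw (\<lambda>\<omega>. (restrict \<omega> W, restrict \<omega> (V - W)))
    {\<omega> \<in> PiE V M. P (restrict \<omega> W) \<and> Q (restrict \<omega> (V - W))}
    ({\<omega> \<in> PiE W M. P \<omega>} \<times> {\<omega> \<in> PiE (V - W) M. Q \<omega>})"
  proof (rule bij_betw_byWitness[where f' =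
        "\<lambda>(\<omega>1, \<omega>2). restrict (\<lambda>v. if v \<in> W then \<omega>1 v else \<omega>2 v) V"], goal_cases)
    case 1
    show ?case
      using assms by (auto simp: PiE_def extensional_def fun_eq_iff)
  next
    case 2
    have "restrict (restrict (\<lambda>v. if v \<in> W then \<omega>1 v else \<omega>2 v) V) W = \<omega>1"
      "restrict (restrict (\<lambda>v. if v \<in> W then \<omega>1 v else \<omega>2 v) V) (V - W) = \<omega>2"
      if "\<omega>1 \<in> PiE W M" "\<omega>2 \<in> PiE (V - W) M" for \<omega>1 \<omega>2
      using that assms by (auto simp: PiE_def extensional_def fun_eq_iff restrict_def)
    then show ?case by auto
  next
    case 3
    show ?case using assms by (auto simp: PiE_def)
  next
    case 4
    have "restrict (restrict (\<lambda>v. if v \<in> W then \<omega>1 v else \<omega>2 v) V) W = \<omega>1"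
      "restrict (restrict (\<lambda>v. if v \<in> W then \<omega>1 v else \<omega>2 v) V) (V - W) = \<omega>2"
      "restrict (\<lambda>v. if v \<in> W then \<omega>1 v else \<omega>2 v) V \<in> PiE V M"
      if "\<omega>1 \<in> PiE W M" "\<omega>2 \<in> PiE (V - W) M" for \<omega>1 \<omega>2
      using that assms by (auto simp: PiE_def extensional_def fun_eq_iff restrict_def)
    then show ?case by auto
  qed
  then show ?thesis by (auto dest!: bij_betw_same_card simp: card_cartesian_product)
qed

section \<open>Random sublists missed by few colors\<close>

text \<open>Passing from \<open>n\<close> to \<open>n - 1\<close> colors multiplies \<open>n choose l\<close> by \<open>(n - l) / n\<close>, which is at
  least \<open>s / (l + s)\<close> as long as \<open>n \<ge> l + s\<close>; the slack \<open>t - 1\<close> in \<open>k\<close> keeps this true for \<open>t\<close>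
  steps.\<close>

lemma binomial_diff_lower:
  fixes k l s t i :: nat
  assumes "s \<ge> 1" "i \<le> t" "l + s + t \<le> k + 1"
  shows "(s / (l + s)) ^ i * (k choose l) \<le> (k - i) choose l"
  using assms(2)
proof (induction i)
  case 0
  then show ?case by simp
next
  case (Suc i)
  define n where "n = k - i"
  have n: "n \<ge> l + s" "n > 0" using Suc.prems assms by (auto simp: n_def)
  have "(n - l) * (n choose l) = n * ((n - 1) choose l)"
    by (rule binomial_absorb_comp)
  hence "(real n - l) * (n choose l) = n * ((n - 1) choose l)"
    using n by (metis of_nat_mult of_nat_diff le_add1 le_trans)
  hence eq: "real ((n - 1) choose l) = (real n - l) / n * (n choose l)"
    using n by (simp add: field_simps)
  have "real s * n \<le> (real n - l) * (l + s)"
  proof -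
    have "real l * (l + s) \<le> real l * n" using n by (intro mult_left_mono) auto
    then show ?thesis by (simp add: algebra_simps)
  qed
  hence "s / (l + s) \<le> (real n - l) / n"
    using n assms(1) by (simp add: divide_simps)
  hence "s / (l + s) * (n choose l) \<le> (n - 1) choose l"
    unfolding eq by (intro mult_right_mono) auto
  moreover have "s / (l + s) * ((s / (l + s)) ^ i * (k choose l)) \<le> s / (l + s) * (n choose l)"
    using Suc by (intro mult_left_mono) (auto simp: n_def)
  ultimately show ?case by (simp add: n_def mult.assoc)
qed

lemma subsets_avoiding_lower:
  fixes A C :: "'b set"
  assumes "finite A" "finite C" "card C \<le> t" "s \<ge> 1" "l + s + t \<le> card A + 1"
  shows "(s / (l + s)) ^ card C * card {S. S \<subseteq> A \<and> card S = l}
    \<le> card {S \<in> {S. S \<subseteq> A \<and> card S = l}. S \<inter> C = {}}"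
proof -
  have "{S \<in> {S. S \<subseteq> A \<and> card S = l}. S \<inter> C = {}} = {S. S \<subseteq> A - C \<and> card S = l}"
    by auto
  moreover have "(card A - card C) choose l \<le> card (A - C) choose l"
    by (intro binomial_right_mono diff_card_le_card_Diff assms)
  moreover have "(s / (l + s)) ^ card C * (card A choose l) \<le> (card A - card C) choose l"
    by (rule binomial_diff_lower) (use assms in auto)
  ultimately show ?thesis
    using assms(1) by (simp add: n_subsets)
qed

definition hit_by_few :: "nat \<Rightarrow> 'b set \<Rightarrow> 'a set \<Rightarrow> ('a \<Rightarrow> 'b set) \<Rightarrow> bool" where
  "hit_by_few j C U \<omega> \<longleftrightarrow>
     (\<exists>X. finite X \<and> card X \<le> j \<and> (\<forall>u\<in>U. \<omega> u \<inter> (C \<union> X) \<noteq> {}))"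

lemma hit_by_few_cong:
  "(\<And>u. u \<in> U \<Longrightarrow> \<omega> u = \<omega>' u) \<Longrightarrow> hit_by_few j C U \<omega> \<longleftrightarrow> hit_by_few j C U \<omega>'"
  by (simp add: hit_by_few_def)

text \<open>If the committed colors \<open>C\<close> miss the sublist revealed next, then one of the \<open>j\<close> free colors
  has to be spent on it.\<close>

lemma hit_by_few_insert_disjoint:
  assumes "hit_by_few j C (insert u U) \<omega>" "\<omega> u \<inter> C = {}"
  shows "j > 0 \<and> (\<exists>c\<in>\<omega> u. hit_by_few (j - 1) (insert c C) U \<omega>)"
proof -
  obtain X where X: "finite X" "card X \<le> j" "\<forall>v\<in>insert u U. \<omega> v \<inter> (C \<union> X) \<noteq> {}"
    using assms(1) by (auto simp: hit_by_few_def)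
  then obtain c where c: "c \<in> \<omega> u" "c \<in> X" using assms(2) by blast
  have "C \<union> X = insert c C \<union> (X - {c})" using c by auto
  moreover have "card (X - {c}) \<le> j - 1" using X c by simp
  ultimately have "hit_by_few (j - 1) (insert c C) U \<omega>"
    unfolding hit_by_few_def using X by (intro exI[of _ "X - {c}"]) auto
  moreover have "j > 0" using X c by (metis card_gt_0_iff empty_iff le_zero_eq not_gr_zero)
  ultimately show ?thesis using c by blast
qed

text \<open>Here \<open>C\<close> are the colors already committed and \<open>j\<close> is the number of colors still free.  Let
  \<open>z\<close> be the probability that the next sublist misses \<open>C\<close>, so \<open>z \<ge> x ^ card C\<close>.  If it is hit,
  the problem stays the same; if not, there are at most \<open>l\<close> ways to commit a new color, and
  \<open>j\<close> drops.  Relative to the claimed bound, this multiplies by \<open>1 - z + z * l / K\<close>.  Since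
  \<open>1 - l / K \<ge> x\<close> and \<open>card C < t\<close>, this is at most \<open>1 - z * x \<le> 1 - x ^ t\<close>: the loss from
  having one color less in \<open>C\<close> exactly pays for the branching.  When \<open>j = 0\<close> there is no
  branching, and the factor is \<open>1 - z \<le> 1 - x ^ t\<close>.\<close>

lemma hit_by_few_upper:
  fixes M :: "'a \<Rightarrow> 'b set set" and x K :: real and l t :: nat
  assumes "finite U" "finite C" "card C + j \<le> t"
    and M: "\<And>u. u \<in> U \<Longrightarrow> finite (M u)"
      "\<And>u S. \<lbrakk>u \<in> U; S \<in> M u\<rbrakk> \<Longrightarrow> finite S \<and> card S \<le> l"
    and avoid: "\<And>u C. \<lbrakk>u \<in> U; finite C; card C \<le> t\<rbrakk> \<Longrightarrow>
      x ^ card C * card (M u) \<le> card {S \<in> M u. S \<inter> C = {}}"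
    and x: "0 \<le> x" "x \<le> 1" and K: "1 \<le> K" "l \<le> (1 - x) * K"
  shows "card {\<omega> \<in> PiE U M. hit_by_few j C U \<omega>}
    \<le> K ^ j * (1 - x ^ t) ^ card U * card (PiE U M)"
  using assms(1-3) M avoid
proof (induction U arbitrary: C j rule: finite_induct)
  case empty
  have "card {\<omega> \<in> PiE {} M. hit_by_few j C {} \<omega>} \<le> card (PiE {} M)"
    by (intro card_mono) auto
  also have "\<dots> = 1" by simp
  finally have "card {\<omega> \<in> PiE {} M. hit_by_few j C {} \<omega>} \<le> 1" .
  moreover have "1 \<le> K ^ j" using K by simp
  ultimately show ?case by simp
next
  case (insert u U)
  define G where "G j C = card {\<omega> \<in> PiE U M. hit_by_few j C U \<omega>}" for j and C :: "'b set"
  define b where "b = (1 - x ^ t) ^ card U * card (PiE U M)"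
  have q: "0 \<le> x ^ t" "x ^ t \<le> 1" using x by (auto simp: power_le_one)
  have b: "b \<ge> 0" unfolding b_def using q by simp
  have finP: "finite (PiE U M)" using insert by (intro finite_PiE) auto
  have G: "G i C' \<le> K ^ i * b" if "finite C'" "card C' + i \<le> t" for i C'
  proof -
    have "G i C' \<le> K ^ i * (1 - x ^ t) ^ card U * card (PiE U M)"
      unfolding G_def by (rule insert.IH[OF that]) (use insert.prems in auto)
    then show ?thesis by (simp add: b_def mult.assoc)
  qed
  define N H D where "N = M u" and "H = {S \<in> N. S \<inter> C \<noteq> {}}" and "D = {S \<in> N. S \<inter> C = {}}"
  have fin: "finite N" "finite H" "finite D" using insert.prems by (auto simp: N_def H_def D_def)
  have N: "N = H \<union> D" "H \<inter> D = {}" by (auto simp: H_def D_def)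
  have cardN: "real (card N) = card H + card D"
    using N fin by (metis card_Un_disjoint of_nat_add)
  define h where "h S = card {\<omega> \<in> PiE U M. hit_by_few j C (insert u U) (\<omega>(u := S))}" for S
  have upd: "hit_by_few i C' U (\<omega>(u := S)) = hit_by_few i C' U \<omega>" for i C' \<omega> S
    using insert.hyps by (intro hit_by_few_cong) auto
  have hH: "h S \<le> K ^ j * b" if "S \<in> H" for S
  proof -
    have "hit_by_few j C U \<omega>" if "hit_by_few j C (insert u U) (\<omega>(u := S))" for \<omega>
    proof -
      have "hit_by_few j C U (\<omega>(u := S))" using that unfolding hit_by_few_def by blast
      then show ?thesis by (simp add: upd)
    qed
    hence "h S \<le> G j C" unfolding h_def G_def using finP by (intro card_mono) auto
    also have "\<dots> \<le> K ^ j * b" using insert.prems by (intro G) auto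
    finally show ?thesis by simp
  qed
  have hD: "h S \<le> (if j = 0 then 0 else l * (K ^ (j - 1) * b))" if "S \<in> D" for S
  proof -
    have S: "S \<inter> C = {}" "finite S" "card S \<le> l"
      using that insert.prems(4)[of u S] by (auto simp: D_def N_def)
    have *: "j > 0 \<and> (\<exists>c\<in>S. hit_by_few (j - 1) (insert c C) U \<omega>)"
      if "hit_by_few j C (insert u U) (\<omega>(u := S))" for \<omega>
      using hit_by_few_insert_disjoint[OF that] S by (simp add: upd)
    show ?thesis
    proof (cases "j = 0")
      case True
      hence "{\<omega> \<in> PiE U M. hit_by_few j C (insert u U) (\<omega>(u := S))} = {}" using * by auto
      then show ?thesis by (simp only: h_def True) simp
    next
      case False
      have "h S \<le> card (\<Union>c\<in>S. {\<omega> \<in> PiE U M. hit_by_few (j - 1) (insert c C) U \<omega>})"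
        unfolding h_def using finP S * by (intro card_mono) auto
      also have "\<dots> \<le> (\<Sum>c\<in>S. G (j - 1) (insert c C))"
        unfolding G_def by (rule card_UN_le) (use S in auto)
      finally have "real (h S) \<le> (\<Sum>c\<in>S. real (G (j - 1) (insert c C)))"
        by (metis of_nat_le_iff of_nat_sum)
      also have "\<dots> \<le> (\<Sum>c\<in>S. K ^ (j - 1) * b)"
      proof (intro sum_mono G)
        fix c
        show "finite (insert c C)" using insert.prems by simp
        have "card (insert c C) \<le> Suc (card C)" using insert.prems(1) by (simp add: card_insert_if)
        thus "card (insert c C) + (j - 1) \<le> t" using insert.prems(2) False by linarith
      qed
      also have "\<dots> = card S * (K ^ (j - 1) * b)" by simp
      also have "\<dots> \<le> l * (K ^ (j - 1) * b)"
        using S b K by (intro mult_right_mono) auto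
      finally show ?thesis using False by simp
    qed
  qed
  have D: "x ^ card C * card N \<le> card D"
    using insert.prems unfolding D_def N_def by auto
  have "real (card {\<omega> \<in> PiE (insert u U) M. hit_by_few j C (insert u U) \<omega>}) = (\<Sum>S\<in>N. h S)"
    unfolding N_def h_def using insert by (subst card_PiE_insert_Collect) auto
  also have "\<dots> = (\<Sum>S\<in>H. h S) + (\<Sum>S\<in>D. h S)"
    using N fin by (simp add: sum.union_disjoint)
  also have "\<dots> \<le> (\<Sum>S\<in>H. K ^ j * b) + (\<Sum>S\<in>D. if j = 0 then 0 else l * (K ^ (j - 1) * b))"
    unfolding of_nat_add of_nat_sum using hH hD by (intro add_mono sum_mono) auto
  also have "\<dots> = card H * (K ^ j * b) + card D * (if j = 0 then 0 else l * (K ^ (j - 1) * b))"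
    by simp
  also have "\<dots> \<le> K ^ j * b * ((1 - x ^ t) * card N)"
  proof (cases "j = 0")
    case True
    have "x ^ t * card N \<le> x ^ card C * card N"
      using x insert.prems True by (intro mult_right_mono power_decreasing) auto
    hence "card H \<le> (1 - x ^ t) * card N" using cardN D by (simp add: algebra_simps)
    then show ?thesis using b True by (simp add: mult_left_mono mult.commute)
  next
    case False
    have "x ^ t * card N \<le> x ^ Suc (card C) * card N"
      using x insert.prems False by (intro mult_right_mono power_decreasing) auto
    also have "\<dots> \<le> x * card D" using D x by (simp add: mult_left_mono mult.assoc)
    finally have xt: "x ^ t * card N \<le> x * card D" .
    have Kj: "K ^ j = K * K ^ (j - 1)" using False by (simp add: power_eq_if)
    have "card H * K + card D * l \<le> card H * K + card D * ((1 - x) * K)"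
      using mult_left_mono[OF K(2), of "real (card D)"] by simp
    also have "\<dots> = K * (card N - x * card D)" by (simp add: cardN algebra_simps)
    also have "\<dots> \<le> K * ((1 - x ^ t) * card N)"
      using xt K by (intro mult_left_mono) (auto simp: algebra_simps)
    finally have "(K ^ (j - 1) * b) * (card H * K + card D * l)
      \<le> (K ^ (j - 1) * b) * (K * ((1 - x ^ t) * card N))"
      using b K by (intro mult_left_mono) auto
    then show ?thesis using False by (simp add: Kj algebra_simps)
  qed
  also have "\<dots> = K ^ j * (1 - x ^ t) ^ card (insert u U) * card (PiE (insert u U) M)"
    using insert.hyps by (simp add: b_def N_def card_PiE algebra_simps)
  finally show ?case .
qed

section \<open>Coloring graphs\<close>

context fin_sgraph
begin

lemma edge_in_V: "{u, v} \<in> E \<Longrightarrow> u \<in> V \<and> v \<in> V \<and> u \<noteq> v"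
  using edges[of "{u, v}"] by (auto simp: card_insert_if split: if_splits)

lemma finite_neighbors: "finite (neighbors E v)"
  using neighbors_subset finite_V finite_subset by blast

lemma neighbors_sym: "u \<in> neighbors E v \<longleftrightarrow> v \<in> neighbors E u"
  by (simp add: neighbors_def insert_commute)

text \<open>Vertices are colored one at a time, keeping \<open>min r d\<close> colors on the \<open>d\<close> colored neighbors of
  every vertex.  A new vertex \<open>u\<close> avoids the colors of its neighbors, and for each neighbor \<open>w\<close>
  that still sees fewer than \<open>r\<close> colors, the colors seen by \<open>w\<close>.  This excludes at most
  \<open>\<Delta> + \<Delta> * (r - 1)\<close> colors.\<close>

lemma dynamic_choosable_greedy:
  assumes "r \<ge> 1" and deg: "\<And>v. v \<in> V \<Longrightarrow> degree E v \<le> \<Delta>" and k: "k > r * \<Delta>"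
  shows "dynamic_choosable r V E k"
  unfolding dynamic_choosable_def
proof (intro allI impI)
  fix L :: "'a \<Rightarrow> nat set"
  assume L: "list_assignment V k L"
  have "\<exists>f. (\<forall>v\<in>W. f v \<in> L v) \<and> (\<forall>u\<in>W. \<forall>v\<in>W. {u, v} \<in> E \<longrightarrow> f u \<noteq> f v) \<and>
      (\<forall>w\<in>V. min r (card (neighbors E w \<inter> W)) \<le> card (f ` (neighbors E w \<inter> W)))"
    if "finite W" "W \<subseteq> V" for W
    using that
  proof (induction W rule: finite_induct)
    case empty
    then show ?case by simp
  next
    case (insert u W)
    then obtain f where f: "\<forall>v\<in>W. f v \<in> L v" "\<forall>u\<in>W. \<forall>v\<in>W. {u, v} \<in> E \<longrightarrow> f u \<noteq> f v"
      "\<forall>w\<in>V. min r (card (neighbors E w \<inter> W)) \<le> card (f ` (neighbors E w \<inter> W))"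
      by auto
    have u: "u \<in> V" using insert.prems by simp
    define seen where "seen w = f ` (neighbors E w \<inter> W)" for w
    have finite_seen: "finite (seen w)" for w
      by (simp add: seen_def finite_neighbors)
    define Z where "Z = {w \<in> neighbors E u. card (seen w) < r}"
    have finite_Z: "finite Z" by (simp add: Z_def finite_neighbors)
    have "card (seen u) \<le> card (neighbors E u \<inter> W)"
      unfolding seen_def by (intro card_image_le) (simp add: finite_neighbors)
    also have "\<dots> \<le> degree E u"
      unfolding degree_def by (intro card_mono finite_neighbors) auto
    finally have 1: "card (seen u) \<le> \<Delta>" using deg[OF u] by linarith
    have "card (\<Union>w\<in>Z. seen w) \<le> (\<Sum>w\<in>Z. card (seen w))"
      by (rule card_UN_le[OF finite_Z])
    also have "\<dots> \<le> (\<Sum>w\<in>Z. r - 1)" by (intro sum_mono) (auto simp: Z_def)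
    also have "\<dots> = card Z * (r - 1)" by simp
    also have "card Z \<le> degree E u"
      unfolding degree_def Z_def by (intro card_mono finite_neighbors) auto
    also have "degree E u \<le> \<Delta>" by (rule deg[OF u])
    finally have 2: "card (\<Union>w\<in>Z. seen w) \<le> \<Delta> * (r - 1)" by simp
    define F where "F = seen u \<union> (\<Union>w\<in>Z. seen w)"
    have "finite F" unfolding F_def using finite_seen finite_Z by auto
    have "card F \<le> \<Delta> + \<Delta> * (r - 1)"
      unfolding F_def by (rule order_trans[OF card_Un_le add_mono[OF 1 2]])
    also have "\<dots> = r * \<Delta>" using assms(1) by (cases r) auto
    finally have "card F < k" using k by linarith
    have "\<not> L u \<subseteq> F"
    proof
      assume "L u \<subseteq> F"
      hence "finite (L u)" "card (L u) < k"
        using \<open>finite F\<close> \<open>card F < k\<close> card_mono[of F "L u"] finite_subset[of "L u" F] by auto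
      then show False using L u by (auto simp: list_assignment_def)
    qed
    then obtain c where c: "c \<in> L u" "c \<notin> F" by blast
    define g where "g = f(u := c)"
    have gW: "g v = f v" if "v \<in> W" for v using that insert.hyps by (auto simp: g_def)
    have gu: "g u = c" by (simp add: g_def)
    have new: "f v \<noteq> c" if "v \<in> W" "{u, v} \<in> E" for v
      using that c by (auto simp: F_def seen_def neighbors_def)
    have "g v1 \<noteq> g v2" if e: "v1 \<in> insert u W" "v2 \<in> insert u W" "{v1, v2} \<in> E" for v1 v2
    proof -
      have "v1 \<noteq> v2" using edge_in_V e by blast
      then consider "v1 = u" "v2 \<in> W" | "v2 = u" "v1 \<in> W" | "v1 \<in> W" "v2 \<in> W"
        using e(1,2) by blast
      then show ?thesis
      proof cases
        case 1
        then show ?thesis using e new[of v2] by (simp add: gu gW)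
      next
        case 2
        then show ?thesis using e new[of v1] by (simp add: gu gW insert_commute)
      next
        case 3
        then show ?thesis using e f(2) by (simp add: gW)
      qed
    qed
    moreover have "min r (card (neighbors E w \<inter> insert u W)) \<le> card (g ` (neighbors E w \<inter> insert u W))"
      if w: "w \<in> V" for w
    proof -
      have img: "g ` (neighbors E w \<inter> W) = seen w" by (auto simp: seen_def gW intro!: image_cong)
      have IH: "min r (card (neighbors E w \<inter> W)) \<le> card (seen w)"
        using f(3) w by (simp add: seen_def)
      show ?thesis
      proof (cases "u \<in> neighbors E w")
        case False
        hence "neighbors E w \<inter> insert u W = neighbors E w \<inter> W" by auto
        then show ?thesis using IH img by simp
      next
        case True
        hence eq: "neighbors E w \<inter> insert u W = insert u (neighbors E w \<inter> W)" by auto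
        hence card: "card (neighbors E w \<inter> insert u W) = Suc (card (neighbors E w \<inter> W))"
          using insert.hyps by (simp add: finite_neighbors)
        have img': "g ` (neighbors E w \<inter> insert u W) = insert c (seen w)"
          unfolding eq image_insert img gu ..
        show ?thesis
        proof (cases "card (seen w) < r")
          case True
          hence "w \<in> Z" using \<open>u \<in> neighbors E w\<close> by (simp add: Z_def neighbors_sym)
          hence "c \<notin> seen w" using c by (auto simp: F_def)
          then show ?thesis unfolding img' card using IH finite_seen by simp
        next
          case False
          have "card (seen w) \<le> card (insert c (seen w))"
            by (intro card_mono) (auto simp: finite_seen)
          then show ?thesis unfolding img' using False by simp
        qed
      qed
    qed
    ultimately show ?case
      using f(1) c(1) by (intro exI[of _ g]) (auto simp: gu gW)
  qed
  from this[OF finite_V] obtain f where f: "\<forall>v\<in>V. f v \<in> L v"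
    "\<forall>u\<in>V. \<forall>v\<in>V. {u, v} \<in> E \<longrightarrow> f u \<noteq> f v"
    "\<forall>w\<in>V. min r (card (neighbors E w \<inter> V)) \<le> card (f ` (neighbors E w \<inter> V))"
    by auto
  have "neighbors E w \<inter> V = neighbors E w" for w using neighbors_subset[of w] by blast
  hence "dynamic_coloring r V E f"
    using f(2,3) edge_in_V by (auto simp: dynamic_coloring_def proper_coloring_def degree_def)
  with f(1) show "\<exists>f. dynamic_coloring r V E f \<and> (\<forall>v\<in>V. f v \<in> L v)" by blast
qed

text \<open>The local lemma applied to random sublists.  Two events for \<open>v\<close> and \<open>w\<close> interact only
  if \<open>v\<close> and \<open>w\<close> have a common neighbor, and there are at most \<open>\<Delta>\<^sup>2\<close> such \<open>w\<close>; since degrees are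
  positive, \<open>v\<close> itself is among them.\<close>

lemma exists_unhit_choice:
  fixes M :: "'a \<Rightarrow> 'b set set" and p :: real
  assumes M: "\<And>u. u \<in> V \<Longrightarrow> finite (M u) \<and> M u \<noteq> {}"
    and deg: "\<And>v. v \<in> V \<Longrightarrow> 1 \<le> degree E v \<and> degree E v \<le> \<Delta>" and "\<Delta> \<ge> 2"
    and p: "p * exp 1 * real (\<Delta>\<^sup>2) \<le> 1"
    and prob: "\<And>v. v \<in> V \<Longrightarrow>
      card {\<omega> \<in> PiE (neighbors E v) M. hit_by_few t {} (neighbors E v) \<omega>}
        \<le> p * card (PiE (neighbors E v) M)"
  shows "\<exists>\<omega>\<in>PiE V M. \<forall>v\<in>V. \<not> hit_by_few t {} (neighbors E v) \<omega>"
proof -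
  define \<Omega> where "\<Omega> = PiE V M"
  define A where "A v = {\<omega> \<in> \<Omega>. hit_by_few t {} (neighbors E v) \<omega>}" for v
  define \<Gamma> where "\<Gamma> v = (\<Union>u\<in>neighbors E v. neighbors E u)" for v
  have "\<Omega> - (\<Union>v\<in>V. A v) \<noteq> {}"
  proof (rule lovasz_local_symmetric[where p = p and m = "\<Delta>\<^sup>2" and \<Gamma> = \<Gamma>])
    show "finite \<Omega>" unfolding \<Omega>_def using M finite_V by (intro finite_PiE) auto
    show "\<Omega> \<noteq> {}" unfolding \<Omega>_def using M by (auto simp: PiE_eq_empty_iff)
    show "finite V" by (rule finite_V)
    show "2 \<le> \<Delta>\<^sup>2" using mult_le_mono[OF assms(3) assms(3)] by (simp add: power2_eq_square)
    show "p * exp 1 * real (\<Delta>\<^sup>2) \<le> 1" by (rule p)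
  next
    fix v assume v: "v \<in> V"
    have "neighbors E v \<noteq> {}" using deg[OF v] by (auto simp: degree_def)
    hence "v \<in> \<Gamma> v" by (auto simp: \<Gamma>_def neighbors_sym)
    moreover have "finite (\<Gamma> v)" by (simp add: \<Gamma>_def finite_neighbors)
    moreover have "card (\<Gamma> v) \<le> \<Delta>\<^sup>2"
    proof -
      have "card (\<Gamma> v) \<le> (\<Sum>u\<in>neighbors E v. card (neighbors E u))"
        unfolding \<Gamma>_def by (rule card_UN_le[OF finite_neighbors])
      also have "\<dots> \<le> (\<Sum>u\<in>neighbors E v. \<Delta>)"
        using deg neighbors_subset unfolding degree_def by (intro sum_mono) blast
      also have "\<dots> \<le> \<Delta>\<^sup>2" using deg[OF v] by (simp add: degree_def power2_eq_square)
      finally show ?thesis .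
    qed
    ultimately show "v \<in> \<Gamma> v \<and> finite (\<Gamma> v) \<and> card (\<Gamma> v) \<le> \<Delta>\<^sup>2" by blast
  next
    fix v T assume v: "v \<in> V" and T: "T \<subseteq> V" "T \<inter> \<Gamma> v = {}"
    let ?N = "neighbors E v"
    define P where "P \<omega> = hit_by_few t {} ?N \<omega>" for \<omega> :: "'a \<Rightarrow> 'b set"
    define Q where "Q \<omega> \<longleftrightarrow> (\<forall>w\<in>T. \<not> hit_by_few t {} (neighbors E w) \<omega>)" for \<omega> :: "'a \<Rightarrow> 'b set"
    have disj: "neighbors E w \<subseteq> V - ?N" if "w \<in> T" for w
    proof -
      have "w \<in> \<Gamma> v" if "u \<in> neighbors E w" "u \<in> ?N" for u
        using that neighbors_sym[of u w] by (auto simp: \<Gamma>_def)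
      then show ?thesis using that T neighbors_subset[of w] by blast
    qed
    have P: "P (restrict \<omega> ?N) = P \<omega>" for \<omega>
      unfolding P_def by (rule hit_by_few_cong) simp
    have Q: "Q (restrict \<omega> (V - ?N)) = Q \<omega>" for \<omega>
    proof -
      have "hit_by_few t {} (neighbors E w) (restrict \<omega> (V - ?N)) =
        hit_by_few t {} (neighbors E w) \<omega>" if "w \<in> T" for w
        using disj[OF that] by (intro hit_by_few_cong) auto
      then show ?thesis by (simp add: Q_def)
    qed
    have B: "\<Omega> - (\<Union>w\<in>T. A w) = {\<omega> \<in> \<Omega>. Q \<omega>}" by (auto simp: A_def Q_def)
    have AB: "A v \<inter> (\<Omega> - (\<Union>w\<in>T. A w)) = {\<omega> \<in> \<Omega>. P \<omega> \<and> Q \<omega>}"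
      by (auto simp: A_def Q_def P_def)
    have "card {\<omega> \<in> \<Omega>. P \<omega> \<and> Q \<omega>} =
      card {\<omega> \<in> PiE ?N M. P \<omega>} * card {\<omega> \<in> PiE (V - ?N) M. Q \<omega>}"
      using card_PiE_split[OF neighbors_subset, of M P v Q] by (simp add: P Q \<Omega>_def)
    moreover have "card {\<omega> \<in> \<Omega>. Q \<omega>} = card (PiE ?N M) * card {\<omega> \<in> PiE (V - ?N) M. Q \<omega>}"
      using card_PiE_split[OF neighbors_subset, of M "\<lambda>_. True" v Q] by (simp add: Q \<Omega>_def)
    moreover have "card {\<omega> \<in> PiE ?N M. P \<omega>} * real (card {\<omega> \<in> PiE (V - ?N) M. Q \<omega>})
      \<le> p * card (PiE ?N M) * real (card {\<omega> \<in> PiE (V - ?N) M. Q \<omega>})"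
      using prob[OF v] by (intro mult_right_mono) (auto simp: P_def)
    ultimately show "card (A v \<inter> (\<Omega> - (\<Union>w\<in>T. A w))) \<le> p * card (\<Omega> - (\<Union>w\<in>T. A w))"
      unfolding AB unfolding B by (simp add: mult.assoc)
  qed
  then show ?thesis by (auto simp: \<Omega>_def A_def)
qed

text \<open>The heart of the theorem, with \<open>t\<close> in the role of \<open>r - 1\<close> and the numerical condition in the
  form that the local lemma needs.  A coloring from sublists \<open>\<omega>\<close> that used at most \<open>t\<close> colors on
  a neighborhood would provide a set of at most \<open>t\<close> colors meeting all sublists there.\<close>

lemma dynamic_choosable_from_choosable:
  fixes l s t k :: nat
  assumes ch: "choosable V E l" and "s \<ge> 1" and k: "l + s + t \<le> k + 1" "t \<ge> 1"
    and deg: "\<And>v. v \<in> V \<Longrightarrow> \<delta> \<le> degree E v \<and> degree E v \<le> \<Delta>" and "\<delta> \<ge> 1" "\<Delta> \<ge> 2"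
    and p: "real k ^ t * (1 - (s / (l + s)) ^ t) ^ \<delta> * exp 1 * real (\<Delta>\<^sup>2) \<le> 1"
  shows "dynamic_choosable (Suc t) V E k"
  unfolding dynamic_choosable_def
proof (intro allI impI)
  fix L :: "'a \<Rightarrow> nat set"
  assume L: "list_assignment V k L"
  have "\<exists>S. S \<subseteq> L v \<and> finite S \<and> card S = k" if "v \<in> V" for v
  proof (cases "finite (L v)")
    case True
    then show ?thesis using L that obtain_subset_with_card_n[of k "L v"]
      by (auto simp: list_assignment_def)
  next
    case False
    then show ?thesis using infinite_arbitrarily_large by blast
  qed
  then obtain L0 where L0: "\<And>v. v \<in> V \<Longrightarrow> L0 v \<subseteq> L v \<and> finite (L0 v) \<and> card (L0 v) = k"
    by metis
  define M where "M v = {S. S \<subseteq> L0 v \<and> card S = l}" for v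
  define x where "x = s / (real l + s)"
  have x: "0 \<le> x" "x \<le> 1" using assms(2) by (auto simp: x_def field_simps)
  have q: "0 \<le> 1 - x ^ t" "1 - x ^ t \<le> 1" using x by (auto simp: power_le_one)
  have M: "finite (M v) \<and> M v \<noteq> {}" if "v \<in> V" for v
  proof
    show "finite (M v)"
      by (rule finite_subset[of _ "Pow (L0 v)"]) (use L0[OF that] in \<open>auto simp: M_def\<close>)
    show "M v \<noteq> {}"
      using L0[OF that] k obtain_subset_with_card_n[of l "L0 v"] by (auto simp: M_def)
  qed
  have "\<exists>\<omega>\<in>PiE V M. \<forall>v\<in>V. \<not> hit_by_few t {} (neighbors E v) \<omega>"
  proof (rule exists_unhit_choice[where p = "real k ^ t * (1 - x ^ t) ^ \<delta>" and \<Delta> = \<Delta>])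
    show "finite (M u) \<and> M u \<noteq> {}" if "u \<in> V" for u using M[OF that] .
    show "1 \<le> degree E v \<and> degree E v \<le> \<Delta>" if "v \<in> V" for v
      using deg[OF that] assms(6) by simp
    show "2 \<le> \<Delta>" by (rule assms)
    show "real k ^ t * (1 - x ^ t) ^ \<delta> * exp 1 * real (\<Delta>\<^sup>2) \<le> 1" using p by (simp add: x_def)
  next
    fix v assume v: "v \<in> V"
    let ?N = "neighbors E v"
    have NV: "u \<in> V" if "u \<in> ?N" for u using that neighbors_subset by blast
    have "real l * (real l + s) \<le> real l * k" using k by (intro mult_left_mono) auto
    hence lk: "l \<le> (1 - x) * k"
      using assms(2) by (simp add: x_def field_simps)
    have "card {\<omega> \<in> PiE ?N M. hit_by_few t {} ?N \<omega>}
      \<le> real k ^ t * (1 - x ^ t) ^ card ?N * card (PiE ?N M)"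
    proof (rule hit_by_few_upper[where l = l])
      fix u S assume "u \<in> ?N" "S \<in> M u"
      then show "finite S \<and> card S \<le> l" using L0[OF NV] by (auto simp: M_def intro: finite_subset)
    next
      fix u and C :: "nat set" assume *: "u \<in> ?N" "finite C" "card C \<le> t"
      show "x ^ card C * card (M u) \<le> card {S \<in> M u. S \<inter> C = {}}"
        using subsets_avoiding_lower[of "L0 u" C t s l] * L0[OF NV[OF *(1)]] assms(2) k
        by (simp add: M_def x_def)
    qed (use M NV x lk k assms(2) finite_neighbors in auto)
    also have "\<dots> \<le> real k ^ t * (1 - x ^ t) ^ \<delta> * card (PiE ?N M)"
      using deg[OF v] q by (intro mult_right_mono mult_left_mono power_decreasing)
        (auto simp: degree_def)
    finally show "card {\<omega> \<in> PiE ?N M. hit_by_few t {} ?N \<omega>}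
      \<le> real k ^ t * (1 - x ^ t) ^ \<delta> * card (PiE ?N M)" .
  qed
  then obtain \<omega> where \<omega>: "\<omega> \<in> PiE V M" "\<And>v. v \<in> V \<Longrightarrow> \<not> hit_by_few t {} (neighbors E v) \<omega>"
    by blast
  have \<omega>V: "\<omega> v \<subseteq> L0 v \<and> card (\<omega> v) = l" if "v \<in> V" for v
    using \<omega>(1) that by (auto simp: M_def PiE_def Pi_def)
  hence "list_assignment V l \<omega>" by (simp add: list_assignment_def)
  with ch obtain f where f: "proper_coloring E f" "\<forall>v\<in>V. f v \<in> \<omega> v"
    unfolding choosable_def by blast
  have "Suc t \<le> card (f ` neighbors E v)" if "v \<in> V" for v
  proof (rule ccontr)
    assume "\<not> Suc t \<le> card (f ` neighbors E v)"
    moreover have "\<omega> u \<inter> f ` neighbors E v \<noteq> {}" if "u \<in> neighbors E v" for u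
      using that f(2) neighbors_subset by blast
    ultimately have "hit_by_few t {} (neighbors E v) \<omega>"
      unfolding hit_by_few_def using finite_neighbors
      by (intro exI[of _ "f ` neighbors E v"]) auto
    with \<omega>(2)[OF that] show False by blast
  qed
  hence "dynamic_coloring (Suc t) V E f"
    using f(1) by (auto simp: dynamic_coloring_def min_le_iff_disj)
  moreover have "\<forall>v\<in>V. f v \<in> L v" using f(2) \<omega>V L0 by blast
  ultimately show "\<exists>f. dynamic_coloring (Suc t) V E f \<and> (\<forall>v\<in>V. f v \<in> L v)" by blast
qed

end

section \<open>The numerical condition\<close>

text \<open>With \<open>q = y ^ t\<close> the hypothesis reads \<open>q * \<delta> \<ge> (t + 2) * ln \<Delta> + t * ln r + 1\<close>, so
  \<open>(1 - q) ^ \<delta> \<le> exp (- q * \<delta>)\<close> is at most \<open>1 / (\<Delta> ^ (t + 2) * r ^ t * e)\<close>.  The factor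
  \<open>k ^ t \<le> (r * \<Delta>) ^ t\<close> leaves exactly \<open>1 / (e * \<Delta>\<^sup>2)\<close>.\<close>

lemma local_lemma_condition:
  fixes y :: real and k r t \<Delta> \<delta> :: nat
  assumes "0 \<le> y" "y \<le> 1" "r \<ge> 1" "\<Delta> \<ge> 1" "k \<le> r * \<Delta>"
    and hyp: "(t + 2) * ln (real \<Delta>) + t * ln (real r) + 1 \<le> y ^ t * \<delta>"
  shows "real k ^ t * (1 - y ^ t) ^ \<delta> * exp 1 * real (\<Delta>\<^sup>2) \<le> 1"
proof -
  define q where "q = y ^ t"
  have q: "0 \<le> q" "q \<le> 1" using assms by (auto simp: q_def power_le_one)
  have "(1 - q) ^ \<delta> \<le> exp (- q) ^ \<delta>"
    using q exp_ge_add_one_self[of "- q"] by (intro power_mono) auto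
  also have "\<dots> = exp (- (q * \<delta>))" by (simp add: mult.commute flip: exp_of_nat_mult)
  also have "\<dots> \<le> exp (- ((t + 2) * ln (real \<Delta>) + t * ln (real r) + 1))"
    using hyp by (simp add: q_def)
  also have "\<dots> = 1 / (real \<Delta> ^ (t + 2) * real r ^ t * exp 1)"
  proof -
    have "exp ((t + 2) * ln (real \<Delta>)) = real \<Delta> ^ (t + 2)" "exp (t * ln (real r)) = real r ^ t"
      using assms by (simp_all only: exp_of_nat_mult) simp_all
    then show ?thesis unfolding exp_minus exp_add by (simp only: inverse_eq_divide)
  qed
  finally have 1: "(1 - q) ^ \<delta> \<le> 1 / (real \<Delta> ^ (t + 2) * real r ^ t * exp 1)" .
  have 2: "real k ^ t \<le> (real r * \<Delta>) ^ t"
    using assms by (intro power_mono) (auto simp flip: of_nat_mult)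
  have "real k ^ t * (1 - q) ^ \<delta>
      \<le> (real r * \<Delta>) ^ t * (1 / (real \<Delta> ^ (t + 2) * real r ^ t * exp 1))"
    using q by (intro mult_mono 1 2) auto
  also have "\<dots> = 1 / (exp 1 * real (\<Delta>\<^sup>2))"
    using assms by (simp add: power_mult_distrib power_add power2_eq_square field_simps)
  finally show ?thesis using assms by (simp add: q_def field_simps)
qed

theorem theorem1p3:
  fixes V :: "'a set" and E :: "'a set set" and r s l \<Delta> \<delta> :: nat
  assumes "fin_sgraph V E"
    and "r \<ge> 2" and "s \<ge> 1" and "l \<ge> 1" and "s \<ge> r - 1"
    and "max_degree V E = \<Delta>" and "min_degree V E = \<delta>" and "choice_number V E = l"
    and "((real r + 1) * ln (real \<Delta>) + (real r - 1) * ln (real r) + 1)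
           * ((real l + real s) / real s) ^ (r - 1) \<le> real \<delta>"
  shows "dynamic_choice_number r V E \<le> choice_number V E + s + r - 2"
proof -
  interpret fin_sgraph V E by (rule assms)
  define k where "k = l + s + r - 2"
  define t where "t = r - 1"
  have t: "r = Suc t" "t \<ge> 1" using assms(2) by (auto simp: t_def)
  have deg: "\<delta> \<le> degree E v \<and> degree E v \<le> \<Delta>" if "v \<in> V" for v
    using that finite_V assms(6,7) by (auto simp: max_degree_def min_degree_def)
  have "\<delta> \<le> \<Delta>" using deg V_nonempty by fastforce
  define a where "a = (t + 2) * ln (real \<Delta>) + t * ln (real r) + 1"
  define y where "y = s / (real l + s)"
  have y: "0 < y" "y \<le> 1" using assms(3) by (auto simp: y_def field_simps)
  have "a * inverse y ^ t \<le> \<delta>"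
    using assms(9) by (simp add: a_def y_def t algebra_simps)
  hence hyp: "a \<le> y ^ t * \<delta>" using y by (simp add: power_inverse field_simps)
  have "y ^ t * \<delta> \<le> 1 * real \<delta>" using y by (intro mult_right_mono) (auto simp: power_le_one)
  hence "a \<le> \<delta>" using hyp by linarith
  (* Maximum degrees 0 and 1 contradict the hypothesis, which forces \<delta> > 1; the convention
     ln 0 = 0 lets the same computation cover \<Delta> = 0. *)
  have "ln (real \<Delta>) \<ge> 0" by (cases "\<Delta> = 0") auto
  hence "(t + 2) * ln (real \<Delta>) \<ge> 0" by simp
  moreover have "t * ln (real r) > 0" using t by simp
  ultimately have "a > 1" by (simp add: a_def)
  with \<open>a \<le> \<delta>\<close> have "\<delta> \<ge> 2" by linarith
  with \<open>\<delta> \<le> \<Delta>\<close> have "\<Delta> \<ge> 2" by linarith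
  have "dynamic_choosable r V E k"
  proof (cases "k \<le> r * \<Delta>")
    case True
    have "real k ^ t * (1 - y ^ t) ^ \<delta> * exp 1 * real (\<Delta>\<^sup>2) \<le> 1"
      using y t True \<open>\<Delta> \<ge> 2\<close> hyp by (intro local_lemma_condition[where r = r]) (auto simp: a_def)
    moreover have "choosable V E l" using choosable_choice_number assms(8) by simp
    ultimately show ?thesis
      unfolding t(1) using assms(3) t deg \<open>\<delta> \<ge> 2\<close> \<open>\<Delta> \<ge> 2\<close>
      by (intro dynamic_choosable_from_choosable[where l = l and s = s and \<Delta> = \<Delta> and \<delta> = \<delta>])
        (auto simp: k_def y_def)
  next
    case False
    then show ?thesis using deg t by (intro dynamic_choosable_greedy[where \<Delta> = \<Delta>]) auto
  qed
  moreover have "k > 0" using assms by (simp add: k_def)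
  ultimately show ?thesis
    unfolding dynamic_choice_number_def assms(8) k_def[symmetric] by (intro Least_le) auto
qed

end
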